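(* Let $f:[a,b]\to\mathbb{R}$ be continuous and strictly increasing, let $h_1,h_2,\dots$ be i.i.d. realizations of the warping process $H$, and let $Y_{ij}=f\circ h_i^{-1}(t_{ij})$, $i=1,\dots,m$, $j=1,\dots,n$. Let $f_{ES}=f\circ\phi^{-1}$ and let $\widehat{f_{ES}}$ be the piecewise linear estimator of $f_{ES}$ defined in the context. Then, almost surely, $$\big\|\widehat{f_{ES}}-f_{ES}\big\|_\infty\longrightarrow0\quad\text{as } m,n\to\infty ,$$ where $\|\cdot\|_\infty$ is the uniform norm on $[a,b]$.
   Context: $H$ is a stochastic process on a probability space $(\Omega,\mathcal A,\mathbf P)$ with values in the space $\mathcal C([a,b])$ of real continuous functions on $[a,b]$, equipped with the uniform norm and its Borel $\sigma$-algebra, such that for almost all $w\in\Omega$ the function $H(w,\cdot)$ is (strictly) increasing with $H(w,a)=a$ and $H(w,b)=b$. $\phi(t)=\mathbf E H(t)$ is its expectation. The observation times are equidistant in $[a,b]$: $t_{ij}=a+(j-1)\frac{b-a}{n-1}$ for all $i$, $j=1,\dots,n$. Convergence $u(m,n)\to c$ as $m,n\to\infty$ means: for all $\epsilon>0$ there is $(m_0,n_0)$ such that $|u(m,n)-c|<\epsilon$ whenever $m>m_0$ and $n>n_0$. Construction of the estimator. For $y\in[f(a),f(b)]$ put $j_i(y)\in\arg\min_{j\in\{1,\dots,n\}}|Y_{ij}-y|$ (ties broken by any fixed rule giving a monotone choice in $y$), $T_i(y)=t_{ij_i(y)}$ and $\widehat{f_{ES}^{-1}}(y)=\frac1m\sum_{i=1}^mT_i(y)$.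 This is an increasing step function of $y$ with jumps at $K=K(m,n)$ points $v_1<\dots<v_K$, where $f(a)=v_0<v_1<\dots<v_K<v_{K+1}=f(b)$; so, for $y\in[f(a),f(b)]\setminus\{v_0,\dots,v_{K+1}\}$, $\widehat{f_{ES}^{-1}}(y)=\sum_{k=0}^{K}u_k\mathbf 1_{(v_k,v_{k+1})}(y)$ with $a=u_0<u_1<\dots<u_K=b$. For $t\in[a,b]$ define $$\widehat{f_{ES}}(t)=\sum_{k=0}^{K-1}\Big(v_k+\frac{v_{k+1}-v_k}{u_{k+1}-u_k}(t-u_k)\Big)\mathbf 1_{[u_k,u_{k+1})}(t)+v_K\mathbf 1_{\{b\}}(t).$$ *)

theory Defs
  imports "HOL-Analysis.Analysis" "HOL-Probability.Probability"
begin

text \<open>The metric space C([a,b]) with the uniform distance; its points are the continuous real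
  functions on [a,b], set to \<open>undefined\<close> outside [a,b].\<close>

definition C_space :: "real \<Rightarrow> real \<Rightarrow> (real \<Rightarrow> real) metric" where
  "C_space a b = cfunspace (top_of_set {a..b}) euclidean_metric"

definition C_borel :: "real \<Rightarrow> real \<Rightarrow> (real \<Rightarrow> real) measure" where
  "C_borel a b = sigma (mspace (C_space a b)) {U. openin (mtopology_of (C_space a b)) U}"

locale warping_process = prob_space M for M :: "'w measure" +
  fixes a b :: real and H :: "'w \<Rightarrow> real \<Rightarrow> real"
  assumes H_random: "H \<in> measurable M (C_borel a b)"
    and H_warp: "AE w in M. strict_mono_on {a..b} (H w) \<and> H w a = a \<and> H w b = b"

definition mean_warp :: "'w measure \<Rightarrow> ('w \<Rightarrow> real \<Rightarrow> real) \<Rightarrow> real \<Rightarrow> real" where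
  "mean_warp M H t = (\<integral>w. H w t \<partial>M)"

definition f_ES :: "'w measure \<Rightarrow> ('w \<Rightarrow> real \<Rightarrow> real) \<Rightarrow> real \<Rightarrow> real \<Rightarrow> (real \<Rightarrow> real) \<Rightarrow> real \<Rightarrow> real" where
  "f_ES M H a b f = f \<circ> the_inv_into {a..b} (mean_warp M H)"

text \<open>The observation time \<open>t\<^sub>i\<^sub>j\<close> (which does not depend on \<open>i\<close>), for \<open>j = 1, \<dots>, n\<close>.\<close>

definition obs_time :: "real \<Rightarrow> real \<Rightarrow> nat \<Rightarrow> nat \<Rightarrow> real" where
  "obs_time a b n j = a + (real j - 1) * (b - a) / (real n - 1)"

text \<open>In the definitions below \<open>hs i\<close> is the observed warping function \<open>h\<^sub>i\<close>, \<open>i \<ge> 1\<close>, for a fixed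
  outcome.\<close>

definition Y_obs :: "real \<Rightarrow> real \<Rightarrow> (real \<Rightarrow> real) \<Rightarrow> (nat \<Rightarrow> real \<Rightarrow> real) \<Rightarrow> nat \<Rightarrow> nat \<Rightarrow> nat \<Rightarrow> real" where
  "Y_obs a b f hs n i j = f (the_inv_into {a..b} (hs i) (obs_time a b n j))"

text \<open>A selection rule: from \<open>n\<close>, the data \<open>Y 1, \<dots>, Y n\<close> and \<open>y\<close> it picks an index in \<open>{1..n}\<close>
  minimising \<open>\<bar>Y j - y\<bar>\<close>. Ties are broken in any way such that the choice is monotone in \<open>y\<close>.
  Monotonicity is asked only for increasing data (almost surely the observed data are increasing):
  for other data no such selection need exist.\<close>

definition nearest_rule :: "(nat \<Rightarrow> (nat \<Rightarrow> real) \<Rightarrow> real \<Rightarrow> nat) \<Rightarrow> bool" where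
  "nearest_rule \<rho> \<longleftrightarrow>
     (\<forall>n\<ge>1. \<forall>Y.
        (\<forall>y. is_arg_min (\<lambda>j. \<bar>Y j - y\<bar>) (\<lambda>j. j \<in> {1..n}) (\<rho> n Y y)) \<and>
        (strict_mono_on {1..n} Y \<longrightarrow> mono (\<rho> n Y)))"

definition T_obs ::
  "(nat \<Rightarrow> (nat \<Rightarrow> real) \<Rightarrow> real \<Rightarrow> nat) \<Rightarrow> real \<Rightarrow> real \<Rightarrow> (real \<Rightarrow> real) \<Rightarrow> (nat \<Rightarrow> real \<Rightarrow> real) \<Rightarrow>
     nat \<Rightarrow> nat \<Rightarrow> real \<Rightarrow> real" where
  "T_obs \<rho> a b f hs n i y = obs_time a b n (\<rho> n (Y_obs a b f hs n i) y)"

definition f_ES_inv_hat ::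
  "(nat \<Rightarrow> (nat \<Rightarrow> real) \<Rightarrow> real \<Rightarrow> nat) \<Rightarrow> real \<Rightarrow> real \<Rightarrow> (real \<Rightarrow> real) \<Rightarrow> (nat \<Rightarrow> real \<Rightarrow> real) \<Rightarrow>
     nat \<Rightarrow> nat \<Rightarrow> real \<Rightarrow> real" where
  "f_ES_inv_hat \<rho> a b f hs m n y = 1 / real m * (\<Sum>i=1..m. T_obs \<rho> a b f hs n i y)"

text \<open>For an increasing step function \<open>F\<close> on \<open>[c,d]\<close>: its jump points
  \<open>step_v 1 < \<dots> < step_v K\<close> in \<open>(c,d)\<close>, with \<open>step_v 0 = c\<close> and \<open>step_v (K+1) = d\<close>, and its
  constant value \<open>step_u k\<close> on the open interval \<open>(step_v k, step_v (k+1))\<close>.\<close>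

definition jump_points :: "real \<Rightarrow> real \<Rightarrow> (real \<Rightarrow> real) \<Rightarrow> real set" where
  "jump_points c d F = {y \<in> {c<..<d}. \<not> isCont F y}"

definition step_K :: "real \<Rightarrow> real \<Rightarrow> (real \<Rightarrow> real) \<Rightarrow> nat" where
  "step_K c d F = card (jump_points c d F)"

definition step_v :: "real \<Rightarrow> real \<Rightarrow> (real \<Rightarrow> real) \<Rightarrow> nat \<Rightarrow> real" where
  "step_v c d F k =
     (if k = 0 then c
      else if k \<le> step_K c d F then sorted_list_of_set (jump_points c d F) ! (k - 1)
      else d)"

definition step_u :: "real \<Rightarrow> real \<Rightarrow> (real \<Rightarrow> real) \<Rightarrow> nat \<Rightarrow> real" where
  "step_u c d F k = (THE x. \<forall>y\<in>{step_v c d F k<..<step_v c d F (k + 1)}. F y = x)"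

text \<open>The piecewise linear inverse of the step function \<open>F\<close>, a function on \<open>[step_u 0, b]\<close>.\<close>

definition pl_inverse :: "real \<Rightarrow> real \<Rightarrow> real \<Rightarrow> (real \<Rightarrow> real) \<Rightarrow> real \<Rightarrow> real" where
  "pl_inverse b c d F t =
     (let K = step_K c d F; v = step_v c d F; u = step_u c d F in
      (\<Sum>k<K. (v k + (v (k + 1) - v k) / (u (k + 1) - u k) * (t - u k)) *
               indicator {u k..<u (k + 1)} t)
      + v K * indicator {b} t)"

definition f_ES_hat ::
  "(nat \<Rightarrow> (nat \<Rightarrow> real) \<Rightarrow> real \<Rightarrow> nat) \<Rightarrow> real \<Rightarrow> real \<Rightarrow> (real \<Rightarrow> real) \<Rightarrow> (nat \<Rightarrow> real \<Rightarrow> real) \<Rightarrow>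
     nat \<Rightarrow> nat \<Rightarrow> real \<Rightarrow> real" where
  "f_ES_hat \<rho> a b f hs m n = pl_inverse b (f a) (f b) (f_ES_inv_hat \<rho> a b f hs m n)"

definition sup_norm :: "real \<Rightarrow> real \<Rightarrow> (real \<Rightarrow> real) \<Rightarrow> real" where
  "sup_norm a b g = (SUP t\<in>{a..b}. \<bar>g t\<bar>)"

definition double_tendsto :: "(nat \<Rightarrow> nat \<Rightarrow> real) \<Rightarrow> real \<Rightarrow> bool" where
  "double_tendsto u c \<longleftrightarrow> (\<forall>\<epsilon>>0. \<exists>m0 n0. \<forall>m>m0. \<forall>n>n0. \<bar>u m n - c\<bar> < \<epsilon>)"

end

(*
  The mean of the h_i converges to phi uniformly: pointwise by the strong law on a fine grid, and
  then everywhere since all functions are increasing and phi is continuous.  Whatever i is,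
  T_i(y) differs from h_i (f^-1 y) by at most one grid step, so the step function f_ES_inv_hat
  converges uniformly to the continuous function phi o f^-1, in m and n jointly.  Hence its jumps
  are small, and its piecewise linear inverse, evaluated at t, is nearly mapped to t by phi o f^-1;
  uniform continuity of f o phi^-1 turns this into uniform convergence of the inverses.
*)

theory Submission
  imports Defs
begin

text \<open>All randomness sits in one almost sure event, fixed before \<open>m\<close> and
  \<open>n\<close> are chosen: every \<open>h i\<close> is a continuous increasing warp, and the
  sample means converge uniformly. On that event the argument is deterministic. Three obstacles
  shape the rest. The estimator is built from the discontinuities of a function, so its inverse is
  studied for any monotone function of finite range that is uniformly close to a continuous
  \<open>G\<close> and takes the right values near both ends. The \<open>h i\<close> are tied to
  \<open>H\<close> only by their law, so their path properties have to be carried over through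
  equality of distributions; for this the set of warps must be Borel in C([a,b]), which is seen from
  evaluations at rational points. Finally, the values at a fixed time are bounded, so the strong law
  follows from Hoeffding's exponential bound and the Borel-Cantelli lemma.\<close>

section \<open>Monotone step functions and their piecewise linear inverses\<close>

text \<open>\<open>A\<close> and \<open>B\<close> collect the points at which \<open>F\<close>
  increases strictly to the right, respectively to the left. \<open>F\<close> is injective on each,
  so both are as finite as the range. At a point of neither set, monotonicity makes \<open>F\<close>
  constant in a neighbourhood.\<close>

lemma finite_discontinuities_mono_finite_range:
  fixes F :: "real \<Rightarrow> real"
  assumes "mono F" "finite (range F)"
  shows "finite {y. \<not> isCont F y}"
proof -
  define A where "A = {y. \<forall>z>y. F y < F z}"
  define B where "B = {y. \<forall>z<y. F z < F y}"
  have "inj_on F A" "inj_on F B"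
    by (auto simp: A_def B_def intro!: linorder_inj_onI')
  moreover have "finite (F ` A)" "finite (F ` B)"
    using assms(2) by (auto intro: finite_subset[of _ "range F"])
  ultimately have "finite (A \<union> B)"
    by (auto dest: finite_imageD)
  moreover have "{y. \<not> isCont F y} \<subseteq> A \<union> B"
  proof (rule subsetI, rule ccontr)
    fix y assume y: "y \<in> {y. \<not> isCont F y}" and "y \<notin> A \<union> B"
    then obtain z1 z2 where z: "z1 > y" "F z1 \<le> F y" "z2 < y" "F y \<le> F z2"
      by (auto simp: A_def B_def not_less)
    have "F x = F y" if "x \<in> {z2<..<z1}" for x
      using z that monoD[OF \<open>mono F\<close>, of x z1] monoD[OF \<open>mono F\<close>, of z2 x]
        monoD[OF \<open>mono F\<close>, of x y] monoD[OF \<open>mono F\<close>, of y x] by (cases "x \<le> y") auto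
    moreover have "eventually (\<lambda>x. x \<in> {z2<..<z1}) (nhds y)"
      using z by (intro eventually_nhds_in_open) auto
    ultimately have "eventually (\<lambda>x. F x = F y) (nhds y)"
      by (auto elim: eventually_mono)
    then have "isCont F y"
      by (subst isCont_cong[where g = "\<lambda>_. F y"]) auto
    with y show False by simp
  qed
  ultimately show ?thesis by (rule finite_subset[rotated])
qed

locale finite_step_function =
  fixes c d :: real and F :: "real \<Rightarrow> real"
  assumes c_less_d: "c < d" and mono_F: "mono F" and finite_range: "finite (range F)"
begin

abbreviation "K \<equiv> step_K c d F"
abbreviation "v \<equiv> step_v c d F"
abbreviation "u \<equiv> step_u c d F"

lemma finite_jump_points: "finite (jump_points c d F)"
  using finite_discontinuities_mono_finite_range[OF mono_F finite_range]
  by (rule finite_subset[rotated]) (auto simp: jump_points_def)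

text \<open>With both end points attached, the nodes form one strictly sorted list, and the three
  cases of \<open>step_v\<close> need not be separated again to compare them.\<close>

lemma v_eq_nth:
  assumes "k \<le> Suc K"
  shows "v k = (c # sorted_list_of_set (jump_points c d F) @ [d]) ! k"
  using assms finite_jump_points
  by (cases k) (auto simp: step_v_def nth_append step_K_def)

lemma v_less:
  assumes "j < k" "k \<le> Suc K"
  shows "v j < v k"
proof -
  let ?L = "c # sorted_list_of_set (jump_points c d F) @ [d]"
  have "x \<in> {c<..<d}" if "x \<in> jump_points c d F" for x
    using that by (simp add: jump_points_def)
  then have "sorted_wrt (<) ?L"
    using finite_jump_points c_less_d by (auto simp: sorted_wrt_append)
  then have "?L ! j < ?L ! k"
    by (rule sorted_wrt_nth_less) (use assms finite_jump_points in \<open>auto simp: step_K_def\<close>)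
  then show ?thesis
    using assms by (simp add: v_eq_nth)
qed

lemma v_le: "j \<le> k \<Longrightarrow> k \<le> Suc K \<Longrightarrow> v j \<le> v k"
  using v_less[of j k] by (cases "j = k") auto

lemma v_0 [simp]: "v 0 = c" and v_Suc_K [simp]: "v (Suc K) = d"
  by (simp_all add: step_v_def)

lemma v_bounds:
  assumes "k \<le> Suc K"
  shows "c \<le> v k" "v k \<le> d"
  using v_le[of 0 k] v_le[of k "Suc K"] assms by auto

lemma v_jump_point:
  assumes "0 < k" "k \<le> K"
  shows "v k \<in> jump_points c d F"
proof -
  have "sorted_list_of_set (jump_points c d F) ! (k - 1) \<in> set (sorted_list_of_set (jump_points c d F))"
    using assms finite_jump_points by (intro nth_mem) (auto simp: step_K_def)
  then show ?thesis
    using assms finite_jump_points by (simp add: step_v_def)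
qed

lemma jump_point_eq_v:
  assumes "x \<in> jump_points c d F"
  obtains k where "k \<le> K" "x = v k"
proof -
  have "x \<in> set (sorted_list_of_set (jump_points c d F))"
    using assms finite_jump_points by simp
  then obtain i where i: "i < K" "x = sorted_list_of_set (jump_points c d F) ! i"
    unfolding in_set_conv_nth by (auto simp: step_K_def)
  show thesis
    by (rule that[of "Suc i"]) (use i in \<open>auto simp: step_v_def\<close>)
qed

text \<open>No jump lies strictly between consecutive nodes, and a continuous function with finitely
  many values on a connected set is constant. The given \<open>y\<close> makes the interval
  nonempty, so the description in \<open>step_u\<close> is unique.\<close>

lemma F_eq_u:
  assumes "k \<le> K" "y \<in> {v k<..<v (Suc k)}"
  shows "F y = u k"
proof -
  let ?I = "{v k<..<v (Suc k)}"
  have "isCont F x" if "x \<in> ?I" for x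
  proof (rule ccontr)
    assume "\<not> isCont F x"
    with that v_bounds[of k] v_bounds[of "Suc k"] assms(1) have "x \<in> jump_points c d F"
      by (auto simp: jump_points_def)
    then obtain j where "j \<le> K" "x = v j"
      by (rule jump_point_eq_v)
    then show False
      using that v_le[of j k] v_le[of "Suc k" j] assms(1) by (cases "j \<le> k") auto
  qed
  then have "continuous_on ?I F"
    by (simp add: continuous_at_imp_continuous_on)
  moreover have "finite (F ` ?I)"
    using finite_range by (rule finite_subset[rotated]) auto
  ultimately have "F constant_on ?I"
    by (intro continuous_finite_range_constant) auto
  then obtain x where x: "\<And>z. z \<in> ?I \<Longrightarrow> F z = x"
    by (auto simp: constant_on_def)
  have "u k = x"
    unfolding step_u_def using x assms(2) by (intro the_equality) auto
  then show ?thesis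
    using x assms(2) by simp
qed

lemma v_dense:
  assumes "k \<le> K"
  obtains y where "y \<in> {v k<..<v (Suc k)}"
  using dense[OF v_less[of k "Suc k"]] assms that by auto

text \<open>Equal values on both sides of a node would, by monotonicity, force the same value at the
  node itself; \<open>F\<close> would then be continuous there, although the node is a jump
  point.\<close>

lemma u_less_Suc:
  assumes "k < K"
  shows "u k < u (Suc k)"
proof -
  obtain y where y: "y \<in> {v k<..<v (Suc k)}" using v_dense[of k] assms by auto
  obtain z where z: "z \<in> {v (Suc k)<..<v (Suc (Suc k))}" using v_dense[of "Suc k"] assms by auto
  have Fy: "F y = u k" and Fz: "F z = u (Suc k)"
    using F_eq_u[OF _ y] F_eq_u[OF _ z] assms by auto
  have "F y \<noteq> F z"
  proof
    assume eq: "F y = F z"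
    have "F x = F y" if "x \<in> {y<..<z}" for x
      using that eq monoD[OF mono_F, of y x] monoD[OF mono_F, of x z] by auto
    moreover have "eventually (\<lambda>x. x \<in> {y<..<z}) (nhds (v (Suc k)))"
      using y z by (intro eventually_nhds_in_open) auto
    ultimately have "eventually (\<lambda>x. F x = F y) (nhds (v (Suc k)))"
      by (auto elim: eventually_mono)
    then have "isCont F (v (Suc k))"
      by (subst isCont_cong[where g = "\<lambda>_. F y"]) auto
    with v_jump_point[of "Suc k"] assms show False
      by (simp add: jump_points_def)
  qed
  moreover have "F y \<le> F z" using y z by (intro monoD[OF mono_F]) auto
  ultimately show ?thesis using Fy Fz by simp
qed

lemma u_less: "j < k \<Longrightarrow> k \<le> K \<Longrightarrow> u j < u k"
  by (induction k) (use u_less_Suc in \<open>auto simp: less_Suc_eq intro: less_trans\<close>)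

lemma u_le: "j \<le> k \<Longrightarrow> k \<le> K \<Longrightarrow> u j \<le> u k"
  using u_less[of j k] by (cases "j = k") auto

text \<open>The intervals between consecutive \<open>u\<close> are disjoint, so a single summand
  survives, and \<open>t \<noteq> b\<close> removes the isolated last term. What remains is a convex
  combination of \<open>v k\<close> and \<open>v (Suc k)\<close> with weight
  \<open>r\<close>.\<close>

lemma pl_inverse_between:
  assumes k: "k < K" and t: "t \<in> {u k..<u (Suc k)}" and b: "t \<noteq> b"
  shows "pl_inverse b c d F t \<in> {v k..v (Suc k)}"
proof -
  define l where "l = (\<lambda>i. v i + (v (i + 1) - v i) / (u (i + 1) - u i) * (t - u i))"
  have "t \<notin> {u i..<u (Suc i)}" if "i < K" "i \<noteq> k" for i
    using that t k u_le[of "Suc i" k] u_le[of "Suc k" i] by (cases "i < k") auto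
  then have "(\<Sum>i<K. l i * indicator {u i..<u (i + 1)} t) = (\<Sum>i<K. if i = k then l k else 0)"
    using t by (intro sum.cong) (auto simp: indicator_def)
  then have eq: "pl_inverse b c d F t = l k"
    using k b by (simp add: pl_inverse_def Let_def l_def)
  define r where "r = (t - u k) / (u (Suc k) - u k)"
  have "0 \<le> r" "r \<le> 1"
    using t by (auto simp: r_def)
  moreover have "l k = v k + (v (Suc k) - v k) * r"
    by (simp add: l_def r_def)
  moreover have "v k \<le> v (Suc k)" using k by (intro v_le) auto
  ultimately show ?thesis
    using eq mult_left_mono[of r 1 "v (Suc k) - v k"] by auto
qed

text \<open>On \<open>[v k, v (k+1)]\<close> the approximant \<open>G\<close> is \<open>\<delta>\<close>-close to \<open>u k\<close> (at the end points by
  continuity), so consecutive values of \<open>u\<close>, between which \<open>t\<close> lies, are \<open>2\<delta>\<close>-close.\<close>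

lemma pl_inverse_approx:
  assumes G: "continuous_on {c..d} G"
    and \<delta>: "\<And>y. y \<in> {c..d} \<Longrightarrow> \<bar>F y - G y\<bar> \<le> \<delta>"
    and left: "eventually (\<lambda>y. F y = a) (at_right c)"
    and right: "eventually (\<lambda>y. F y = b) (at_left d)"
    and t: "t \<in> {a..b}"
  shows "pl_inverse b c d F t \<in> {c..d} \<and> \<bar>G (pl_inverse b c d F t) - t\<bar> \<le> 3 * \<delta>"
proof -
  have G_u: "\<bar>u k - G y\<bar> \<le> \<delta>" if k: "k \<le> K" and y: "y \<in> {v k..v (Suc k)}" for k y
  proof -
    have less: "v k < v (Suc k)" using v_less[of k "Suc k"] k by simp
    have "{v k..v (Suc k)} \<subseteq> {c..d}" using v_bounds[of k] v_bounds[of "Suc k"] k by auto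
    then have cont: "continuous_on (closure {v k<..<v (Suc k)}) (\<lambda>y. \<bar>u k - G y\<bar>)"
      using less by (intro continuous_intros continuous_on_subset[OF G]) auto
    show ?thesis
    proof (rule continuous_le_on_closure[OF cont])
      fix x assume x: "x \<in> {v k<..<v (Suc k)}"
      then show "\<bar>u k - G x\<bar> \<le> \<delta>"
        using F_eq_u[OF k x] \<delta>[of x] v_bounds[of k] v_bounds[of "Suc k"] k by auto
    qed (use y less in auto)
  qed
  have \<delta>0: "0 \<le> \<delta>" using \<delta>[of c] c_less_d by force
  \<comment> \<open>A point close enough to \<open>c\<close> lies before the first jump and has the
    prescribed value, which identifies \<open>u 0\<close>; \<open>u K\<close> is found in the same
    way at \<open>d\<close>.\<close>
  have "eventually (\<lambda>y. y \<in> {c<..<v 1}) (at_right c)"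
    using v_less[of 0 1] by (intro eventually_at_right_real) auto
  with left have "eventually (\<lambda>y. F y = a \<and> y \<in> {c<..<v 1}) (at_right c)"
    by eventually_elim auto
  then obtain y where "F y = a" "y \<in> {c<..<v 1}"
    using eventually_happens[of _ "at_right c"] by auto
  then have u0: "u 0 = a"
    using F_eq_u[of 0 y] by simp
  have "eventually (\<lambda>y. y \<in> {v K<..<d}) (at_left d)"
    using v_less[of K "Suc K"] by (intro eventually_at_left_real) auto
  with right have "eventually (\<lambda>y. F y = b \<and> y \<in> {v K<..<d}) (at_left d)"
    by eventually_elim auto
  then obtain y where "F y = b" "y \<in> {v K<..<d}"
    using eventually_happens[of _ "at_left d"] by auto
  then have uK: "u K = b"
    using F_eq_u[of K y] by simp
  show ?thesis
  proof (cases "t = b")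
    case True
    have "(\<Sum>i<K. (v i + (v (i + 1) - v i) / (u (i + 1) - u i) * (t - u i)) *
               indicator {u i..<u (i + 1)} t) = 0"
    proof (intro sum.neutral ballI)
      fix i assume "i \<in> {..<K}"
      then have "u (Suc i) \<le> t" using u_le[of "Suc i" K] uK True by auto
      then show "(v i + (v (i + 1) - v i) / (u (i + 1) - u i) * (t - u i)) *
               indicator {u i..<u (i + 1)} t = 0" by simp
    qed
    then have "pl_inverse b c d F t = v K"
      using True by (simp add: pl_inverse_def Let_def)
    moreover have "\<bar>G (v K) - b\<bar> \<le> \<delta>"
      using G_u[of K "v K"] v_less[of K "Suc K"] uK by auto
    ultimately show ?thesis
      using True \<delta>0 v_bounds[of K] by auto
  next
    case False
    have "\<exists>k<K. t \<in> {u k..<u (Suc k)}"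
    proof -
      \<comment> \<open>Such an index exists because \<open>t < b = u K\<close>; minimality yields
        \<open>u k \<le> t\<close>. The case \<open>K = 0\<close> cannot occur, as it would give
        \<open>a = b = t\<close>.\<close>
      define k where "k = (LEAST k. t < u (Suc k))"
      have ex: "t < u (Suc (K - 1))"
        using t False u0 uK by (cases K) auto
      have 1: "t < u (Suc k)"
        unfolding k_def using ex by (rule LeastI)
      have 2: "k \<le> K - 1"
        unfolding k_def using ex by (rule Least_le)
      have "K \<noteq> 0" using t False u0 uK by (cases K) auto
      moreover have "u k \<le> t"
      proof (cases k)
        case 0
        then show ?thesis using u0 t by simp
      next
        case (Suc k')
        then have "\<not> t < u (Suc k')"
          using not_less_Least[of k' "\<lambda>k. t < u (Suc k)"] by (auto simp: k_def)
        then show ?thesis using Suc by simp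
      qed
      ultimately show ?thesis using 1 2 by (intro exI[of _ k]) auto
    qed
    then obtain k where k: "k < K" "t \<in> {u k..<u (Suc k)}" by blast
    define p where "p = pl_inverse b c d F t"
    have p: "p \<in> {v k..v (Suc k)}"
      unfolding p_def using pl_inverse_between[OF k False] .
    have "\<bar>u k - G p\<bar> \<le> \<delta>" using G_u[OF _ p] k by simp
    moreover have "\<bar>u k - G (v (Suc k))\<bar> \<le> \<delta>" "\<bar>u (Suc k) - G (v (Suc k))\<bar> \<le> \<delta>"
      using G_u[of k "v (Suc k)"] G_u[of "Suc k" "v (Suc k)"] v_less[of k "Suc k"]
        v_less[of "Suc k" "Suc (Suc k)"] k by auto
    \<comment> \<open>One \<open>\<delta>\<close> separates \<open>G p\<close> from
      \<open>u k\<close>; two more bound the gap from \<open>u k\<close> to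
      \<open>u (Suc k)\<close>, which contains \<open>t\<close>.\<close>
    ultimately have "\<bar>G p - t\<bar> \<le> 3 * \<delta>" using k(2) by auto
    moreover have "p \<in> {c..d}"
      using p v_bounds[of k] v_bounds[of "Suc k"] k by auto
    ultimately show ?thesis by (simp add: p_def)
  qed
qed

end

section \<open>Inverses of increasing functions, warping functions and the observation grid\<close>

lemma strict_mono_on_Icc_inverse:
  fixes f :: "real \<Rightarrow> real"
  assumes "a \<le> b" and cont: "continuous_on {a..b} f" and mono: "strict_mono_on {a..b} f"
  shows strict_mono_on_Icc_image: "f ` {a..b} = {f a..f b}"
    and the_inv_into_Icc_mem: "\<And>y. y \<in> {f a..f b} \<Longrightarrow> the_inv_into {a..b} f y \<in> {a..b}"
    and f_the_inv_into_Icc: "\<And>y. y \<in> {f a..f b} \<Longrightarrow> f (the_inv_into {a..b} f y) = y"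
    and the_inv_into_Icc_f: "\<And>x. x \<in> {a..b} \<Longrightarrow> the_inv_into {a..b} f (f x) = x"
    and strict_mono_on_the_inv_into_Icc: "strict_mono_on {f a..f b} (the_inv_into {a..b} f)"
    and continuous_on_the_inv_into_Icc: "continuous_on {f a..f b} (the_inv_into {a..b} f)"
proof -
  have inj: "inj_on f {a..b}" using mono by (rule strict_mono_on_imp_inj_on)
  have le: "f x \<le> f y" if "x \<in> {a..b}" "y \<in> {a..b}" "x \<le> y" for x y
    using strict_mono_onD[OF mono, of x y] that by (cases "x = y") auto
  show image: "f ` {a..b} = {f a..f b}"
  proof (rule equalityI)
    show "f ` {a..b} \<subseteq> {f a..f b}" using le \<open>a \<le> b\<close> by auto
    show "{f a..f b} \<subseteq> f ` {a..b}"
    proof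
      fix y assume "y \<in> {f a..f b}"
      then obtain x where "a \<le> x" "x \<le> b" "f x = y"
        using IVT'[of f a y b] cont \<open>a \<le> b\<close> by auto
      then show "y \<in> f ` {a..b}" by auto
    qed
  qed
  show mem: "the_inv_into {a..b} f y \<in> {a..b}" if "y \<in> {f a..f b}" for y
    using the_inv_into_into[OF inj, of y "{a..b}"] that image by auto
  show f_inv: "f (the_inv_into {a..b} f y) = y" if "y \<in> {f a..f b}" for y
    using f_the_inv_into_f[OF inj, of y] that image by auto
  show inv_f: "the_inv_into {a..b} f (f x) = x" if "x \<in> {a..b}" for x
    using the_inv_into_f_f[OF inj that] .
  show "strict_mono_on {f a..f b} (the_inv_into {a..b} f)"
  proof (rule strict_mono_onI)
    fix x y assume xy: "x \<in> {f a..f b}" "y \<in> {f a..f b}" "x < y"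
    show "the_inv_into {a..b} f x < the_inv_into {a..b} f y"
    proof (rule ccontr)
      assume "\<not> ?thesis"
      then have "f (the_inv_into {a..b} f y) \<le> f (the_inv_into {a..b} f x)"
        using mem xy by (intro le) auto
      then show False using f_inv xy by auto
    qed
  qed
  have "continuous_on (f ` {a..b}) (the_inv_into {a..b} f)"
    by (rule continuous_on_inv) (use cont inv_f in auto)
  then show "continuous_on {f a..f b} (the_inv_into {a..b} f)" by (simp only: image)
qed

text \<open>Joins the continuity built into C([a,b]) with the almost sure properties of
  \<open>H\<close>, so that one predicate on paths carries everything the deterministic part
  assumes.\<close>

definition warp :: "real \<Rightarrow> real \<Rightarrow> (real \<Rightarrow> real) \<Rightarrow> bool" where
  "warp a b g \<longleftrightarrow> continuous_on {a..b} g \<and> strict_mono_on {a..b} g \<and> g a = a \<and> g b = b"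

lemma warp_mono:
  assumes "warp a b g" "x \<in> {a..b}" "y \<in> {a..b}" "x \<le> y"
  shows "g x \<le> g y"
  using assms strict_mono_onD[of "{a..b}" g x y] by (cases "x = y") (auto simp: warp_def)

lemma warp_bounds:
  assumes "warp a b g" "x \<in> {a..b}"
  shows "g x \<in> {a..b}"
  using warp_mono[OF assms(1), of a x] warp_mono[OF assms(1), of x b] assms
  by (auto simp: warp_def)

lemma obs_time_mono: "a < b \<Longrightarrow> 2 \<le> n \<Longrightarrow> i < j \<Longrightarrow> obs_time a b n i < obs_time a b n j"
  by (auto simp: obs_time_def intro!: divide_strict_right_mono mult_strict_right_mono)

lemma obs_time_1: "obs_time a b n (Suc 0) = a"
  by (simp add: obs_time_def)

lemma obs_time_n: "2 \<le> n \<Longrightarrow> obs_time a b n n = b"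
  by (simp add: obs_time_def)

lemma obs_time_Suc: "obs_time a b n (Suc j) = obs_time a b n j + (b - a) / (real n - 1)"
  by (simp add: obs_time_def add_divide_distrib algebra_simps diff_divide_distrib)

lemma obs_time_le: "a < b \<Longrightarrow> 2 \<le> n \<Longrightarrow> i \<le> j \<Longrightarrow> obs_time a b n i \<le> obs_time a b n j"
  using obs_time_mono[of a b n i j] by (cases "i = j") auto

lemma obs_time_mem:
  assumes "a < b" "2 \<le> n" "j \<in> {1..n}"
  shows "obs_time a b n j \<in> {a..b}"
  using obs_time_le[of a b n "Suc 0" j] obs_time_le[of a b n j n] assms
  by (auto simp: obs_time_1 obs_time_n)

section \<open>The estimator for one fixed outcome\<close>

locale nearest_estimator =
  fixes a b :: real and f :: "real \<Rightarrow> real" and \<rho> :: "nat \<Rightarrow> (nat \<Rightarrow> real) \<Rightarrow> real \<Rightarrow> nat"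
    and hs :: "nat \<Rightarrow> real \<Rightarrow> real"
  assumes ab: "a < b"
    and f_cont: "continuous_on {a..b} f" and f_mono: "strict_mono_on {a..b} f"
    and rule: "nearest_rule \<rho>"
    and hs: "\<And>i. 1 \<le> i \<Longrightarrow> warp a b (hs i)"
begin

abbreviation "f_inv \<equiv> the_inv_into {a..b} f"

lemma f_less: "f a < f b"
  using strict_mono_onD[OF f_mono, of a b] ab by simp

lemmas f_inverse = strict_mono_on_Icc_inverse[OF less_imp_le[OF ab] f_cont f_mono]

context
  fixes i n :: nat
  assumes i: "1 \<le> i" and n: "2 \<le> n"
begin

lemma hs_inverse:
  shows "\<And>s. s \<in> {a..b} \<Longrightarrow> the_inv_into {a..b} (hs i) s \<in> {a..b}"
    and "\<And>s. s \<in> {a..b} \<Longrightarrow> the_inv_into {a..b} (hs i) (hs i s) = s"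
    and "strict_mono_on {a..b} (the_inv_into {a..b} (hs i))"
    and "the_inv_into {a..b} (hs i) a = a"
    and "the_inv_into {a..b} (hs i) b = b"
proof -
  have w: "continuous_on {a..b} (hs i)" "strict_mono_on {a..b} (hs i)" "hs i a = a" "hs i b = b"
    using hs[OF i] by (auto simp: warp_def)
  note inv = strict_mono_on_Icc_inverse[OF less_imp_le[OF ab] w(1,2), unfolded w]
  show "\<And>s. s \<in> {a..b} \<Longrightarrow> the_inv_into {a..b} (hs i) s \<in> {a..b}"
    and inv_f: "\<And>s. s \<in> {a..b} \<Longrightarrow> the_inv_into {a..b} (hs i) (hs i s) = s"
    and "strict_mono_on {a..b} (the_inv_into {a..b} (hs i))"
    using inv by auto
  show "the_inv_into {a..b} (hs i) a = a" "the_inv_into {a..b} (hs i) b = b"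
    using inv_f[of a] inv_f[of b] w ab by auto
qed

lemma Y_obs_less:
  assumes "j \<in> {1..n}" "k \<in> {1..n}" "j < k"
  shows "Y_obs a b f hs n i j < Y_obs a b f hs n i k"
  unfolding Y_obs_def using assms obs_time_mem[OF ab n] obs_time_mono[OF ab n]
  by (intro strict_mono_onD[OF f_mono] strict_mono_onD[OF hs_inverse(3)] hs_inverse(1)) auto

lemma strict_mono_Y_obs: "strict_mono_on {1..n} (Y_obs a b f hs n i)"
  using Y_obs_less by (intro strict_mono_onI) auto

lemma Y_obs_1: "Y_obs a b f hs n i 1 = f a"
  by (simp add: Y_obs_def obs_time_1 hs_inverse)

lemma Y_obs_n: "Y_obs a b f hs n i n = f b"
  using n by (simp add: Y_obs_def obs_time_n hs_inverse)

lemma nearest_index: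
  shows nearest_index_mem: "\<rho> n (Y_obs a b f hs n i) y \<in> {1..n}"
    and nearest_index_min: "\<And>j. j \<in> {1..n} \<Longrightarrow>
      \<bar>Y_obs a b f hs n i (\<rho> n (Y_obs a b f hs n i) y) - y\<bar> \<le> \<bar>Y_obs a b f hs n i j - y\<bar>"
proof -
  have "is_arg_min (\<lambda>j. \<bar>Y_obs a b f hs n i j - y\<bar>) (\<lambda>j. j \<in> {1..n}) (\<rho> n (Y_obs a b f hs n i) y)"
    using rule n by (simp add: nearest_rule_def)
  then show "\<rho> n (Y_obs a b f hs n i) y \<in> {1..n}"
    "\<And>j. j \<in> {1..n} \<Longrightarrow>
      \<bar>Y_obs a b f hs n i (\<rho> n (Y_obs a b f hs n i) y) - y\<bar> \<le> \<bar>Y_obs a b f hs n i j - y\<bar>"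
    by (auto simp: is_arg_min_linorder)
qed

lemma mono_T_obs: "mono (T_obs \<rho> a b f hs n i)"
proof -
  have "mono (\<rho> n (Y_obs a b f hs n i))"
    using rule n strict_mono_Y_obs by (simp add: nearest_rule_def)
  then show ?thesis
    using obs_time_le[OF ab n] by (auto simp: mono_def T_obs_def)
qed

lemma T_obs_mem: "T_obs \<rho> a b f hs n i y \<in> obs_time a b n ` {1..n}"
  using nearest_index_mem by (auto simp: T_obs_def)

text \<open>If the chosen time were more than one grid step away from \<open>hs i (f_inv y)\<close>, the neighbouring
  grid time on the side of \<open>hs i (f_inv y)\<close> would give a strictly better index.\<close>

lemma T_obs_error:
  assumes y: "y \<in> {f a..f b}"
  shows "\<bar>T_obs \<rho> a b f hs n i y - hs i (f_inv y)\<bar> \<le> (b - a) / (real n - 1)"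
proof -
  define Y where "Y = Y_obs a b f hs n i"
  define s where "s = hs i (f_inv y)"
  define j where "j = \<rho> n Y y"
  define \<Delta> where "\<Delta> = (b - a) / (real n - 1)"
  let ?t = "obs_time a b n"
  have fy: "f_inv y \<in> {a..b}" using f_inverse(2)[OF y] .
  have s: "s \<in> {a..b}" unfolding s_def using warp_bounds[OF hs[OF i] fy] .
  have j: "j \<in> {1..n}" and j_min: "\<And>k. k \<in> {1..n} \<Longrightarrow> \<bar>Y j - y\<bar> \<le> \<bar>Y k - y\<bar>"
    unfolding j_def Y_def using nearest_index by auto
  \<comment> \<open>Expressing \<open>y\<close> as the value of the increasing curve at time
    \<open>s\<close> turns comparisons of \<open>y\<close> with the data into comparisons of
    \<open>s\<close> with grid times.\<close>
  have y_eq: "y = f (the_inv_into {a..b} (hs i) s)"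
    using hs_inverse(2)[OF fy] f_inverse(3)[OF y] by (simp add: s_def)
  have less: "f (the_inv_into {a..b} (hs i) x) < f (the_inv_into {a..b} (hs i) z)"
    if "x \<in> {a..b}" "z \<in> {a..b}" "x < z" for x z
    using that by (intro strict_mono_onD[OF f_mono] strict_mono_onD[OF hs_inverse(3)] hs_inverse(1))
  have Y_gt: "y < Y k" if "k \<in> {1..n}" "s < ?t k" for k
    unfolding y_eq Y_def Y_obs_def using that obs_time_mem[OF ab n] s by (intro less) auto
  have Y_lt: "Y k < y" if "k \<in> {1..n}" "?t k < s" for k
    unfolding y_eq Y_def Y_obs_def using that obs_time_mem[OF ab n] s by (intro less) auto
  have "?t j \<le> s + \<Delta>"
  proof (rule ccontr)
    assume less: "\<not> ?t j \<le> s + \<Delta>"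
    moreover have "0 < \<Delta>" using ab n by (simp add: \<Delta>_def)
    ultimately have "j \<noteq> Suc 0" using s by (auto simp: obs_time_1)
    with j obtain k where k: "j = Suc k" "k \<in> {1..n}" by (cases j) auto
    then have "s < ?t k" using less by (simp add: obs_time_Suc \<Delta>_def)
    moreover have "Y k < Y j" using Y_obs_less[of k j] k j by (simp add: Y_def)
    ultimately show False using Y_gt[of k] k j_min[of k] by auto
  qed
  moreover have "s - \<Delta> \<le> ?t j"
  proof (rule ccontr)
    assume less: "\<not> s - \<Delta> \<le> ?t j"
    moreover have "0 < \<Delta>" using ab n by (simp add: \<Delta>_def)
    ultimately have "j \<noteq> n" using s n by (auto simp: obs_time_n)
    with j have k: "Suc j \<in> {1..n}" by auto
    have "?t (Suc j) < s" using less by (simp add: obs_time_Suc \<Delta>_def)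
    moreover have "Y j < Y (Suc j)" using Y_obs_less[of j "Suc j"] k j by (simp add: Y_def)
    ultimately show False using Y_lt[of "Suc j"] k j_min[of "Suc j"] by auto
  qed
  ultimately show ?thesis
    by (simp add: T_obs_def s_def j_def Y_def \<Delta>_def abs_le_iff)
qed

text \<open>Below the midpoint of the first two observations the first one is strictly nearest. This
  secures the initial value \<open>a\<close> of the step function; the mirror statement secures its
  final value \<open>b\<close>.\<close>

lemma T_obs_near_left: "eventually (\<lambda>y. T_obs \<rho> a b f hs n i y = a) (at_right (f a))"
proof -
  define Y where "Y = Y_obs a b f hs n i"
  have "Y 1 < Y 2" using Y_obs_less[of 1 2] n by (simp add: Y_def)
  then have "eventually (\<lambda>y. y \<in> {f a<..<(f a + Y 2) / 2}) (at_right (f a))"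
    using Y_obs_1 by (intro eventually_at_right_real) (auto simp: Y_def)
  then show ?thesis
  proof eventually_elim
    case (elim y)
    have "\<rho> n Y y = 1"
    proof (rule ccontr)
      assume neq: "\<rho> n Y y \<noteq> 1"
      have mem: "\<rho> n Y y \<in> {1..n}" unfolding Y_def by (rule nearest_index_mem)
      then have "Y 2 \<le> Y (\<rho> n Y y)"
        using neq Y_obs_less[of 2 "\<rho> n Y y"] by (cases "\<rho> n Y y = 2") (auto simp: Y_def)
      moreover have "\<bar>Y (\<rho> n Y y) - y\<bar> \<le> \<bar>Y 1 - y\<bar>"
        unfolding Y_def using n by (intro nearest_index_min) auto
      ultimately show False using elim Y_obs_1 by (auto simp: Y_def)
    qed
    then show ?case by (simp add: T_obs_def Y_def obs_time_1)
  qed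
qed

lemma T_obs_near_right: "eventually (\<lambda>y. T_obs \<rho> a b f hs n i y = b) (at_left (f b))"
proof -
  define Y where "Y = Y_obs a b f hs n i"
  have "Y (n - 1) < Y n" using Y_obs_less[of "n - 1" n] n by (simp add: Y_def)
  then have "eventually (\<lambda>y. y \<in> {(f b + Y (n - 1)) / 2<..<f b}) (at_left (f b))"
    using Y_obs_n by (intro eventually_at_left_real) (auto simp: Y_def)
  then show ?thesis
  proof eventually_elim
    case (elim y)
    have "\<rho> n Y y = n"
    proof (rule ccontr)
      assume neq: "\<rho> n Y y \<noteq> n"
      have mem: "\<rho> n Y y \<in> {1..n}" unfolding Y_def by (rule nearest_index_mem)
      with neq have "\<rho> n Y y < n - 1 \<or> \<rho> n Y y = n - 1" by auto
      then have "Y (\<rho> n Y y) \<le> Y (n - 1)"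
        using Y_obs_less[of "\<rho> n Y y" "n - 1"] mem n by (auto simp: Y_def)
      moreover have "\<bar>Y (\<rho> n Y y) - y\<bar> \<le> \<bar>Y n - y\<bar>"
        unfolding Y_def using n by (intro nearest_index_min) auto
      ultimately show False using elim Y_obs_n by (auto simp: Y_def)
    qed
    then show ?case using n by (simp add: T_obs_def Y_def obs_time_n)
  qed
qed

end

context
  fixes m n :: nat
  assumes m: "1 \<le> m" and n: "2 \<le> n"
begin

lemma mono_f_ES_inv_hat: "mono (f_ES_inv_hat \<rho> a b f hs m n)"
  unfolding f_ES_inv_hat_def using mono_T_obs[OF _ n]
  by (intro monoI mult_left_mono sum_mono) (auto simp: mono_def)

text \<open>The value at \<open>y\<close> depends only on the tuple of chosen times, an element of a
  finite product of grids.\<close>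

lemma finite_range_f_ES_inv_hat: "finite (range (f_ES_inv_hat \<rho> a b f hs m n))"
proof (rule finite_subset)
  show "range (f_ES_inv_hat \<rho> a b f hs m n) \<subseteq>
    (\<lambda>T. 1 / real m * (\<Sum>i=1..m. T i)) ` ({1..m} \<rightarrow>\<^sub>E obs_time a b n ` {1..n})"
  proof (rule image_subsetI)
    fix y
    have "restrict (\<lambda>i. T_obs \<rho> a b f hs n i y) {1..m} \<in> {1..m} \<rightarrow>\<^sub>E obs_time a b n ` {1..n}"
      using T_obs_mem[OF _ n] by auto
    then show "f_ES_inv_hat \<rho> a b f hs m n y \<in>
      (\<lambda>T. 1 / real m * (\<Sum>i=1..m. T i)) ` ({1..m} \<rightarrow>\<^sub>E obs_time a b n ` {1..n})"
      by (rule rev_image_eqI) (simp add: f_ES_inv_hat_def)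
  qed
qed (intro finite_imageI finite_PiE, auto)

text \<open>Every curve obeys the same deterministic grid error, so the average does too. Since
  \<open>m\<close> does not enter the bound, the two limits decouple.\<close>

lemma f_ES_inv_hat_error:
  assumes "y \<in> {f a..f b}"
  shows "\<bar>f_ES_inv_hat \<rho> a b f hs m n y - 1 / real m * (\<Sum>i=1..m. hs i (f_inv y))\<bar>
    \<le> (b - a) / (real n - 1)"
proof -
  have "\<bar>\<Sum>i=1..m. T_obs \<rho> a b f hs n i y - hs i (f_inv y)\<bar>
      \<le> (\<Sum>i=1..m. \<bar>T_obs \<rho> a b f hs n i y - hs i (f_inv y)\<bar>)"
    by (rule sum_abs)
  also have "\<dots> \<le> (\<Sum>i=1..m. (b - a) / (real n - 1))"
    using T_obs_error[OF _ n assms] by (intro sum_mono) auto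
  finally have "\<bar>\<Sum>i=1..m. T_obs \<rho> a b f hs n i y - hs i (f_inv y)\<bar> / real m
      \<le> (b - a) / (real n - 1)"
    using m by (simp add: field_simps)
  moreover have "f_ES_inv_hat \<rho> a b f hs m n y - 1 / real m * (\<Sum>i=1..m. hs i (f_inv y))
    = (\<Sum>i=1..m. T_obs \<rho> a b f hs n i y - hs i (f_inv y)) / real m"
    by (simp add: f_ES_inv_hat_def sum_subtractf diff_divide_distrib)
  ultimately show ?thesis by simp
qed

lemma f_ES_inv_hat_near_left:
  "eventually (\<lambda>y. f_ES_inv_hat \<rho> a b f hs m n y = a) (at_right (f a))"
proof -
  have "eventually (\<lambda>y. \<forall>i\<in>{1..m}. T_obs \<rho> a b f hs n i y = a) (at_right (f a))"
    using T_obs_near_left[OF _ n] by (intro eventually_ball_finite) auto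
  then show ?thesis
    by eventually_elim (use m in \<open>simp add: f_ES_inv_hat_def\<close>)
qed

lemma f_ES_inv_hat_near_right:
  "eventually (\<lambda>y. f_ES_inv_hat \<rho> a b f hs m n y = b) (at_left (f b))"
proof -
  have "eventually (\<lambda>y. \<forall>i\<in>{1..m}. T_obs \<rho> a b f hs n i y = b) (at_left (f b))"
    using T_obs_near_right[OF _ n] by (intro eventually_ball_finite) auto
  then show ?thesis
    by eventually_elim (use m in \<open>simp add: f_ES_inv_hat_def\<close>)
qed

end

lemma f_ES_hat_tendsto:
  assumes \<phi>: "warp a b \<phi>"
    and lim: "uniform_limit {a..b} (\<lambda>m x. 1 / real m * (\<Sum>i=1..m. hs i x)) \<phi> sequentially"
  shows "double_tendsto (\<lambda>m n. sup_norm a b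
    (\<lambda>t. f_ES_hat \<rho> a b f hs m n t - (f \<circ> the_inv_into {a..b} \<phi>) t)) 0"
  unfolding double_tendsto_def
proof (intro allI impI)
  fix \<epsilon> :: real assume "0 < \<epsilon>"
  define S where "S = f \<circ> the_inv_into {a..b} \<phi>"
  have w: "continuous_on {a..b} \<phi>" "strict_mono_on {a..b} \<phi>" "\<phi> a = a" "\<phi> b = b"
    using \<phi> by (auto simp: warp_def)
  note \<phi>_inv = strict_mono_on_Icc_inverse[OF less_imp_le[OF ab] w(1,2), unfolded w]
  have "continuous_on {a..b} S"
    unfolding S_def using \<phi>_inv(2)
    by (intro continuous_on_compose \<phi>_inv(6) continuous_on_subset[OF f_cont]) auto
  then have "uniformly_continuous_on {a..b} S"
    by (intro compact_uniformly_continuous) auto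
  then obtain \<eta> where "0 < \<eta>" and
    \<eta>: "\<And>x y. x \<in> {a..b} \<Longrightarrow> y \<in> {a..b} \<Longrightarrow> dist y x < \<eta> \<Longrightarrow> dist (S y) (S x) < \<epsilon> / 2"
    unfolding uniformly_continuous_on_def using \<open>0 < \<epsilon>\<close> by (metis half_gt_zero)
  \<comment> \<open>Chosen so that the error \<open>3 * \<delta>\<close> of the piecewise linear
    inverse stays below \<open>\<eta>\<close>.\<close>
  define \<delta> where "\<delta> = \<eta> / 4"
  have "0 < \<delta>" using \<open>0 < \<eta>\<close> by (simp add: \<delta>_def)
  then obtain m0 where m0: "\<And>m x. m \<ge> m0 \<Longrightarrow> x \<in> {a..b} \<Longrightarrow>
      dist (1 / real m * (\<Sum>i=1..m. hs i x)) (\<phi> x) < \<delta> / 2"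
    using lim unfolding uniform_limit_sequentially_iff by (metis half_gt_zero)
  \<comment> \<open>Half of \<open>\<delta>\<close> is spent on the sampling error, half on the grid
    step. The summand 2 also guarantees at least two grid points.\<close>
  define n0 where "n0 = nat \<lceil>2 * (b - a) / \<delta>\<rceil> + 2"
  show "\<exists>m0 n0. \<forall>m>m0. \<forall>n>n0. \<bar>sup_norm a b
      (\<lambda>t. f_ES_hat \<rho> a b f hs m n t - (f \<circ> the_inv_into {a..b} \<phi>) t) - 0\<bar> < \<epsilon>"
  proof (intro exI allI impI)
    fix m n assume mn: "m > m0" "n > n0"
    then have m: "1 \<le> m" and n: "2 \<le> n" by (auto simp: n0_def)
    define F where "F = f_ES_inv_hat \<rho> a b f hs m n"
    define G where "G = \<phi> \<circ> f_inv"
    interpret finite_step_function "f a" "f b" F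
      by unfold_locales
        (use f_less mono_f_ES_inv_hat[OF m n] finite_range_f_ES_inv_hat[OF m n] in \<open>auto simp: F_def\<close>)
    have G_cont: "continuous_on {f a..f b} G"
      unfolding G_def using f_inverse(2)
      by (intro continuous_on_compose f_inverse(6) continuous_on_subset[OF w(1)]) auto
    have "2 * (b - a) / \<delta> \<le> real n - 1"
      using mn(2) by (simp add: n0_def) linarith
    then have step: "(b - a) / (real n - 1) \<le> \<delta> / 2"
      using n \<open>0 < \<delta>\<close> by (simp add: field_simps)
    have FG: "\<bar>F y - G y\<bar> \<le> \<delta>" if y: "y \<in> {f a..f b}" for y
    proof -
      have "\<bar>1 / real m * (\<Sum>i=1..m. hs i (f_inv y)) - \<phi> (f_inv y)\<bar> < \<delta> / 2"
        using m0[of m "f_inv y"] mn f_inverse(2)[OF y] by (simp add: dist_real_def)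
      then show ?thesis
        using f_ES_inv_hat_error[OF m n y] step unfolding F_def G_def o_def by linarith
    qed
    have bound: "\<bar>f_ES_hat \<rho> a b f hs m n t - S t\<bar> \<le> \<epsilon> / 2" if t: "t \<in> {a..b}" for t
    proof -
      define p where "p = f_ES_hat \<rho> a b f hs m n t"
      have p: "p \<in> {f a..f b}" "\<bar>G p - t\<bar> \<le> 3 * \<delta>"
        using pl_inverse_approx[OF G_cont FG _ _ t] f_ES_inv_hat_near_left[OF m n]
          f_ES_inv_hat_near_right[OF m n]
        by (auto simp: p_def f_ES_hat_def F_def)
      have fp: "f_inv p \<in> {a..b}" using f_inverse(2)[OF p(1)] .
      have "G p \<in> {a..b}" using warp_bounds[OF \<phi> fp] by (simp add: G_def)
      moreover have "dist (G p) t < \<eta>"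
        using p(2) \<open>0 < \<eta>\<close> by (simp add: dist_real_def \<delta>_def)
      ultimately have "dist (S (G p)) (S t) < \<epsilon> / 2" using \<eta> t by blast
      \<comment> \<open>\<open>S\<close> inverts \<open>G\<close>, so the estimate \<open>p\<close>
        is itself a value of \<open>S\<close>, at a point within \<open>\<eta>\<close> of
        \<open>t\<close>.\<close>
      moreover have "S (G p) = p"
        using \<phi>_inv(4)[OF fp] f_inverse(3)[OF p(1)] by (simp add: S_def G_def)
      ultimately show ?thesis by (simp add: dist_real_def p_def)
    qed
    define g where "g = (\<lambda>t. f_ES_hat \<rho> a b f hs m n t - S t)"
    have "(SUP t\<in>{a..b}. \<bar>g t\<bar>) \<le> \<epsilon> / 2"
      using ab bound by (intro cSUP_least) (auto simp: g_def)
    \<comment> \<open>Shows that the supremum is nonnegative, so its absolute value is controlled by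
      the upper bound alone.\<close>
    moreover have "\<bar>g a\<bar> \<le> (SUP t\<in>{a..b}. \<bar>g t\<bar>)"
      using ab bound by (intro cSUP_upper bdd_aboveI2[of _ _ "\<epsilon> / 2"]) (auto simp: g_def)
    ultimately have "\<bar>sup_norm a b g\<bar> < \<epsilon>"
      unfolding sup_norm_def using \<open>0 < \<epsilon>\<close> by linarith
    then show "\<bar>sup_norm a b (\<lambda>t. f_ES_hat \<rho> a b f hs m n t - (f \<circ> the_inv_into {a..b} \<phi>) t) - 0\<bar> < \<epsilon>"
      by (simp add: g_def S_def)
  qed
qed

end

section \<open>The strong law for bounded variables and the passage to uniform convergence\<close>

text \<open>Hoeffding's inequality bounds the probability of a deviation of size
  \<open>\<epsilon>\<close> by \<open>2 * q ^ m\<close> with \<open>q < 1\<close>. These bounds are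
  summable, so by Borel-Cantelli almost surely only finitely many such deviations occur.\<close>

lemma (in prob_space) slln_interval_bounded:
  fixes X :: "nat \<Rightarrow> 'a \<Rightarrow> real"
  assumes indep: "indep_vars (\<lambda>_. borel) X {1..}"
    and distr: "\<And>i. 1 \<le> i \<Longrightarrow> distr M borel (X i) = distr M borel Y"
    and Y: "random_variable borel Y" "AE w in M. Y w \<in> {a..b}" and "a < b"
  shows "AE w in M. (\<lambda>m. 1 / real m * (\<Sum>i=1..m. X i w)) \<longlonglongrightarrow> expectation Y"
proof -
  define \<mu> where "\<mu> = expectation Y"
  define avg where "avg = (\<lambda>m w. 1 / real m * (\<Sum>i=1..m. X i w))"
  have X [measurable]: "random_variable borel (X i)" if "1 \<le> i" for i
    using indep that by (auto simp: indep_vars_def)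
  have avg [measurable]: "random_variable borel (avg m)" for m
    unfolding avg_def by (intro borel_measurable_times borel_measurable_const borel_measurable_sum X) auto
  have "AE w in M. eventually (\<lambda>m. \<bar>avg m w - \<mu>\<bar> < \<epsilon>) sequentially" if "0 < \<epsilon>" for \<epsilon>
  proof -
    define A where "A = (\<lambda>m. {w \<in> space M. \<epsilon> \<le> \<bar>avg m w - \<mu>\<bar>})"
    define q where "q = exp (- 2 * \<epsilon>\<^sup>2 / (b - a)\<^sup>2)"
    have q: "0 < q" "q < 1" using \<open>0 < \<epsilon>\<close> \<open>a < b\<close> by (auto simp: q_def divide_neg_pos)
    have A [measurable]: "A m \<in> events" for m
      unfolding A_def by measurable
    have "prob (A m) \<le> 2 * q ^ m" if "1 \<le> m" for m
    proof -
      interpret Hoeffding_ineq_iid M "{1..m}" X Y a b \<mu>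
        by unfold_locales
          (use distr Y indep_vars_subset[OF indep] in \<open>auto simp: \<mu>_def\<close>)
      have "prob {w \<in> space M. \<bar>(\<Sum>i\<in>{1..m}. X i w) / real (card {1..m}) - \<mu>\<bar> \<ge> \<epsilon>}
          \<le> 2 * exp (- 2 * real (card {1..m}) * \<epsilon>\<^sup>2 / (b - a)\<^sup>2)"
        using \<open>0 < \<epsilon>\<close> \<open>a < b\<close> that by (intro Hoeffding_ineq_abs_ge') auto
      also have "exp (- 2 * real (card {1..m}) * \<epsilon>\<^sup>2 / (b - a)\<^sup>2) = q ^ m"
        by (simp add: q_def mult_ac flip: exp_of_nat_mult)
      finally show ?thesis by (simp add: A_def avg_def)
    qed
    moreover have "summable (\<lambda>m. 2 * q ^ m)"
      using q by (intro summable_mult summable_geometric) auto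
    ultimately have sum: "summable (\<lambda>m. prob (A m))"
      by (metis (no_types, lifting) measure_nonneg abs_of_nonneg real_norm_def summable_comparison_test')
    have "AE w in M. eventually (\<lambda>m. w \<in> space M - A m) sequentially"
      by (rule borel_cantelli_AE1[OF A _ sum]) (simp add: emeasure_eq_measure)
    then show ?thesis
      by (rule AE_mp) (intro AE_I2 impI, erule eventually_mono, auto simp: A_def)
  qed
  \<comment> \<open>The exceptional null set depends on \<open>\<epsilon>\<close>; restricting to
    the countably many values 1/(k+1) leaves a single one.\<close>
  then have "AE w in M. \<forall>k. eventually (\<lambda>m. \<bar>avg m w - \<mu>\<bar> < inverse (real (Suc k))) sequentially"
    by (subst AE_all_countable) auto
  then show ?thesis
  proof eventually_elim
    case (elim w)
    have "(\<lambda>m. avg m w) \<longlonglongrightarrow> \<mu>"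
    proof (rule tendstoI)
      fix e :: real assume "0 < e"
      then obtain k where "inverse (real (Suc k)) < e" using reals_Archimedean by blast
      then show "eventually (\<lambda>m. dist (avg m w) \<mu> < e) sequentially"
        using elim[rule_format, of k] by (auto simp: dist_real_def elim!: eventually_mono)
    qed
    then show ?case by (simp add: avg_def \<mu>_def)
  qed
qed

text \<open>As in Polya's theorem, monotonicity squeezes \<open>g m x\<close> between the values of \<open>g m\<close> at the
  neighbouring grid points.\<close>

lemma uniform_limit_mono_on_grid:
  fixes g :: "nat \<Rightarrow> real \<Rightarrow> real"
  assumes "a < b" and mono: "\<And>m. mono_on {a..b} (g m)" and cont: "continuous_on {a..b} \<phi>"
    and lim: "\<And>N k. 1 \<le> N \<Longrightarrow> k \<le> N \<Longrightarrow>
      (\<lambda>m. g m (a + real k * (b - a) / real N)) \<longlonglongrightarrow> \<phi> (a + real k * (b - a) / real N)"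
  shows "uniform_limit {a..b} g \<phi> sequentially"
proof (rule uniform_limitI)
  fix e :: real assume "0 < e"
  have "uniformly_continuous_on {a..b} \<phi>"
    using cont by (rule compact_uniformly_continuous) simp
  then obtain \<eta> where "0 < \<eta>" and
    \<eta>: "\<And>x y. x \<in> {a..b} \<Longrightarrow> y \<in> {a..b} \<Longrightarrow> dist y x < \<eta> \<Longrightarrow> dist (\<phi> y) (\<phi> x) < e / 2"
    unfolding uniformly_continuous_on_def using \<open>0 < e\<close> by (metis half_gt_zero)
  obtain N :: nat where N: "(b - a) / \<eta> < real N" using reals_Archimedean2 by blast
  have "0 < (b - a) / \<eta>" using \<open>0 < \<eta>\<close> \<open>a < b\<close> by simp
  then have N0: "0 < real N" using N by linarith
  have N\<eta>: "(b - a) / real N < \<eta>" using N N0 \<open>0 < \<eta>\<close> by (simp add: field_simps)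
  define s where "s = (\<lambda>k. a + real k * (b - a) / real N)"
  have "eventually (\<lambda>m. \<forall>k\<in>{..N}. dist (g m (s k)) (\<phi> (s k)) < e / 2) sequentially"
  proof (intro eventually_ball_finite ballI)
    fix k assume "k \<in> {..N}"
    then have "(\<lambda>m. g m (s k)) \<longlonglongrightarrow> \<phi> (s k)" unfolding s_def using N0 by (intro lim) auto
    then show "eventually (\<lambda>m. dist (g m (s k)) (\<phi> (s k)) < e / 2) sequentially"
      using \<open>0 < e\<close> by (intro tendstoD) auto
  qed simp
  then show "eventually (\<lambda>m. \<forall>x\<in>{a..b}. dist (g m x) (\<phi> x) < e) sequentially"
  proof eventually_elim
    case (elim m)
    show ?case
    proof
      fix x assume x: "x \<in> {a..b}"
      \<comment> \<open>The position of \<open>x\<close> in units of the grid. Floor and ceiling,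
        rather than floor and its successor, keep the right neighbour inside the grid when
        \<open>x = b\<close>.\<close>
      define z where "z = (x - a) * real N / (b - a)"
      have z: "0 \<le> z" "z \<le> real N" and x_eq: "x = a + z * (b - a) / real N"
        using x N0 \<open>a < b\<close> by (auto simp: z_def field_simps)
      define k l where "k = nat \<lfloor>z\<rfloor>" and "l = nat \<lceil>z\<rceil>"
      have kl: "real k \<le> z" "z < real k + 1" "z \<le> real l" "real l < z + 1" "k \<le> N" "l \<le> N"
        using z unfolding k_def l_def by linarith+
      have s_diff: "s i - x = (real i - z) * ((b - a) / real N)" for i
        by (simp add: s_def x_eq diff_divide_distrib left_diff_distrib right_diff_distrib)
      have mem: "s i \<in> {a..b}" if "i \<le> N" for i
        using that N0 \<open>a < b\<close> mult_left_le_one_le[of "b - a" "real i / real N"]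
        by (auto simp: s_def)
      have near: "dist (s i) x < \<eta>" if "\<bar>real i - z\<bar> \<le> 1" for i
      proof -
        have "\<bar>s i - x\<bar> = \<bar>real i - z\<bar> * ((b - a) / real N)"
          unfolding s_diff using N0 \<open>a < b\<close> by (simp add: abs_mult)
        also have "\<dots> \<le> (b - a) / real N"
          using that N0 \<open>a < b\<close> by (intro mult_left_le_one_le) auto
        finally show ?thesis using N\<eta> by (simp add: dist_real_def)
      qed
      have "0 \<le> (b - a) / real N" using N0 \<open>a < b\<close> by simp
      then have "s k - x \<le> 0" "0 \<le> s l - x"
        unfolding s_diff using kl by (simp_all only: mult_nonpos_nonneg mult_nonneg_nonneg diff_ge_0_iff_ge diff_le_0_iff_le)
      then have "s k \<le> x" "x \<le> s l" by simp_all
      then have "g m (s k) \<le> g m x" "g m x \<le> g m (s l)"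
        by - (rule mono_onD[OF mono], use x mem kl in auto)+
      moreover have "dist (\<phi> (s k)) (\<phi> x) < e / 2"
        by (rule \<eta>) (use x mem kl near in auto)
      moreover have "dist (\<phi> (s l)) (\<phi> x) < e / 2"
        by (rule \<eta>) (use x mem kl near in auto)
      moreover have "dist (g m (s k)) (\<phi> (s k)) < e / 2" "dist (g m (s l)) (\<phi> (s l)) < e / 2"
        using elim kl by auto
      ultimately show "dist (g m x) (\<phi> x) < e"
        unfolding dist_real_def by linarith
    qed
  qed
qed

section \<open>Borel sets of C([a,b])\<close>

lemma openin_C_space_subset:
  "{U. openin (mtopology_of (C_space a b)) U} \<subseteq> Pow (mspace (C_space a b))"
proof
  fix U assume "U \<in> {U. openin (mtopology_of (C_space a b)) U}"
  then have "U \<subseteq> topspace (mtopology_of (C_space a b))"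
    by (intro openin_subset) simp
  then show "U \<in> Pow (mspace (C_space a b))"
    by simp
qed

lemma space_C_borel: "space (C_borel a b) = mspace (C_space a b)"
  unfolding C_borel_def by (rule space_measure_of[OF openin_C_space_subset])

lemma openin_sets_C_borel:
  "openin (mtopology_of (C_space a b)) U \<Longrightarrow> U \<in> sets (C_borel a b)"
  unfolding C_borel_def sets_measure_of[OF openin_C_space_subset]
  by (rule sigma_sets.Basic) simp

lemma C_space_continuous:
  assumes "g \<in> space (C_borel a b)"
  shows "continuous_on {a..b} g"
proof -
  have "continuous_map (top_of_set {a..b}) (mtopology_of euclidean_metric) g"
    using assms unfolding space_C_borel C_space_def mspace_cfunspace by blast
  then show ?thesis by simp
qed

text \<open>Evaluation at a point of [a,b] is 1-Lipschitz for the uniform distance, so preimages of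
  open sets are open.\<close>

lemma measurable_eval_C_borel [measurable]:
  assumes s: "s \<in> {a..b}"
  shows "(\<lambda>g. g s) \<in> borel_measurable (C_borel a b)"
proof (rule borel_measurableI)
  fix S :: "real set" assume "open S"
  let ?U = "(\<lambda>g. g s) -` S \<inter> space (C_borel a b)"
  interpret C: Metric_space "mspace (C_space a b)" "mdist (C_space a b)"
    by (rule Metric_space_mspace_mdist)
  have "openin C.mtopology ?U"
    unfolding C.openin_mtopology
  proof (intro conjI allI impI)
    fix g assume g: "g \<in> ?U"
    then obtain r where r: "0 < r" "\<And>x. dist x (g s) < r \<Longrightarrow> x \<in> S"
      using \<open>open S\<close> unfolding open_dist by auto
    have "C.mball g r \<subseteq> ?U"
    proof
      fix k assume k: "k \<in> C.mball g r"
      then have mem: "g \<in> mspace (C_space a b)" "k \<in> mspace (C_space a b)"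
        and less: "mdist (C_space a b) g k < r" by auto
      have "mdist euclidean_metric (g s) (k s) \<le> mdist (C_space a b) g k"
        unfolding C_space_def
        by (rule mdist_cfunspace_imp_mdist_le[OF mem[unfolded C_space_def] order_refl]) (use s in simp)
      then have "dist (k s) (g s) < r" using less by (simp add: dist_commute)
      then show "k \<in> ?U" using r mem by (simp add: space_C_borel)
    qed
    then show "\<exists>r>0. C.mball g r \<subseteq> ?U" using r by auto
  qed (simp add: space_C_borel)
  then show "?U \<in> sets (C_borel a b)"
    by (intro openin_sets_C_borel) (simp add: mtopology_of_def)
qed

text \<open>Replaces uncountably many inequalities by countably many, as measurability requires.
  Continuity carries the rational inequalities to real points, but only in weak form.\<close>

lemma warp_iff_rational:
  assumes "a < b" "continuous_on {a..b} g"
  shows "warp a b g \<longleftrightarrow>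
    (\<forall>p\<in>\<rat> \<inter> {a..b}. \<forall>q\<in>\<rat> \<inter> {a..b}. p < q \<longrightarrow> g p < g q) \<and> g a = a \<and> g b = b"
proof (intro iffI conjI)
  assume R: "(\<forall>p\<in>\<rat> \<inter> {a..b}. \<forall>q\<in>\<rat> \<inter> {a..b}. p < q \<longrightarrow> g p < g q) \<and> g a = a \<and> g b = b"
  have lower: "g x \<le> g q" if xq: "a \<le> x" "x < q" "q \<le> b" "q \<in> \<rat>" for x q
  proof (rule ccontr)
    assume "\<not> g x \<le> g q"
    then have "0 < g x - g q" by simp
    then obtain e where e: "0 < e" "\<And>y. y \<in> {a..b} \<Longrightarrow> dist y x < e \<Longrightarrow> dist (g y) (g x) < g x - g q"
      using assms(2)[unfolded continuous_on_iff, rule_format, of x "g x - g q"] xq by auto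
    obtain p where p: "p \<in> \<rat>" "x < p" "p < min q (x + e)"
      using Rats_dense_in_real[of x "min q (x + e)"] e xq by auto
    have "g p < g q" using R p xq by auto
    moreover have "dist (g p) (g x) < g x - g q" by (rule e(2)) (use p xq in \<open>auto simp: dist_real_def\<close>)
    ultimately show False by (auto simp: dist_real_def)
  qed
  have upper: "g p \<le> g y" if py: "a \<le> p" "p < y" "y \<le> b" "p \<in> \<rat>" for y p
  proof (rule ccontr)
    assume "\<not> g p \<le> g y"
    then have "0 < g p - g y" by simp
    then obtain e where e: "0 < e" "\<And>z. z \<in> {a..b} \<Longrightarrow> dist z y < e \<Longrightarrow> dist (g z) (g y) < g p - g y"
      using assms(2)[unfolded continuous_on_iff, rule_format, of y "g p - g y"] py by auto
    obtain q where q: "q \<in> \<rat>" "max p (y - e) < q" "q < y"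
      using Rats_dense_in_real[of "max p (y - e)" y] e py by auto
    have "g p < g q" using R q py by auto
    moreover have "dist (g q) (g y) < g p - g y" by (rule e(2)) (use q py in \<open>auto simp: dist_real_def\<close>)
    ultimately show False by (auto simp: dist_real_def)
  qed
  have "strict_mono_on {a..b} g"
  proof (rule strict_mono_onI)
    fix x y assume xy: "x \<in> {a..b}" "y \<in> {a..b}" "x < y"
    \<comment> \<open>Two rationals are inserted between \<open>x\<close> and \<open>y\<close>:
      strictness comes from \<open>g p < g q\<close>, the outer comparisons being weak.\<close>
    obtain p where p: "p \<in> \<rat>" "x < p" "p < y" using Rats_dense_in_real[OF \<open>x < y\<close>] by auto
    obtain q where q: "q \<in> \<rat>" "p < q" "q < y" using Rats_dense_in_real[OF \<open>p < y\<close>] by auto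
    have "g x \<le> g p" using lower p xy by auto
    also have "g p < g q" using R p q xy by auto
    also have "g q \<le> g y" using upper q p xy by auto
    finally show "g x < g y" .
  qed
  then show "warp a b g" using R assms(2) by (simp add: warp_def)
qed (simp_all add: warp_def strict_mono_on_def)

lemma measurable_warp [measurable]:
  assumes "a < b"
  shows "Measurable.pred (C_borel a b) (warp a b)"
proof -
  have [measurable]: "(\<lambda>g. g a) \<in> borel_measurable (C_borel a b)"
    "(\<lambda>g. g b) \<in> borel_measurable (C_borel a b)"
    using assms by (auto intro: measurable_eval_C_borel)
  have ends: "Measurable.pred (C_borel a b) (\<lambda>g. g a = a)" "Measurable.pred (C_borel a b) (\<lambda>g. g b = b)"
    by measurable
  have less: "Measurable.pred (C_borel a b) (\<lambda>g. g x < g y)" if "x \<in> {a..b}" "y \<in> {a..b}" for x y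
    using measurable_eval_C_borel[OF that(1)] measurable_eval_C_borel[OF that(2)]
    by (rule borel_measurable_pred_less)
  \<comment> \<open>Quantifying over the countable type \<open>rat\<close> makes the countable
    closure rules applicable.\<close>
  have "Measurable.pred (C_borel a b) (\<lambda>g.
      (\<forall>p q :: rat. of_rat p \<in> {a..b} \<longrightarrow> of_rat q \<in> {a..b} \<longrightarrow> (of_rat p :: real) < of_rat q \<longrightarrow>
        g (of_rat p) < g (of_rat q)) \<and> g a = a \<and> g b = b)"
    by (intro pred_intros_logic(3) pred_intros_countable(1) pred_intros_imp' less ends)
  moreover have "warp a b g \<longleftrightarrow>
      (\<forall>p q :: rat. of_rat p \<in> {a..b} \<longrightarrow> of_rat q \<in> {a..b} \<longrightarrow> (of_rat p :: real) < of_rat q \<longrightarrow>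
        g (of_rat p) < g (of_rat q)) \<and> g a = a \<and> g b = b" if "g \<in> space (C_borel a b)" for g
    unfolding warp_iff_rational[OF assms C_space_continuous[OF that]] Rats_def by auto
  ultimately show ?thesis
    by (rule iffD2[OF measurable_cong, rotated])
qed

section \<open>The warping process, its mean and its sample\<close>

context warping_process
begin

lemma AE_warp: "AE w in M. warp a b (H w)"
proof -
  have "continuous_on {a..b} (H w)" if "w \<in> space M" for w
    using C_space_continuous measurable_space[OF H_random that] .
  then have "AE w in M. continuous_on {a..b} (H w)" by auto
  with H_warp show ?thesis
    by eventually_elim (auto simp: warp_def)
qed

lemma random_variable_H [measurable]: "s \<in> {a..b} \<Longrightarrow> random_variable borel (\<lambda>w. H w s)"
  using measurable_compose[OF H_random measurable_eval_C_borel] .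

lemma AE_H_mem: "s \<in> {a..b} \<Longrightarrow> AE w in M. H w s \<in> {a..b}"
  using AE_warp by eventually_elim (rule warp_bounds)

lemma AE_norm_H: "s \<in> {a..b} \<Longrightarrow> AE w in M. norm (H w s) \<le> \<bar>a\<bar> + \<bar>b\<bar>"
  using AE_H_mem by (rule AE_mp) auto

lemma integrable_H: "s \<in> {a..b} \<Longrightarrow> integrable M (\<lambda>w. H w s)"
  by (rule integrable_const_bound[OF AE_norm_H]) auto

text \<open>Continuity passes to the mean by dominated convergence, with constant bound
  \<open>\<bar>a\<bar> + \<bar>b\<bar>\<close>. Strictness survives integration because the strict
  inequality holds almost everywhere on a space of positive measure.\<close>

lemma warp_mean_warp:
  assumes "a < b"
  shows "warp a b (mean_warp M H)"
  unfolding warp_def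
proof (intro conjI)
  show "continuous_on {a..b} (mean_warp M H)"
    unfolding continuous_on_sequentially comp_def mean_warp_def
  proof (intro allI ballI impI)
    fix x s assume x: "s \<in> {a..b}" "(\<forall>n. x n \<in> {a..b}) \<and> x \<longlonglongrightarrow> s"
    show "(\<lambda>n. \<integral>w. H w (x n) \<partial>M) \<longlonglongrightarrow> (\<integral>w. H w s \<partial>M)"
    proof (rule integral_dominated_convergence[where w = "\<lambda>_. \<bar>a\<bar> + \<bar>b\<bar>"])
      show "AE w in M. (\<lambda>n. H w (x n)) \<longlonglongrightarrow> H w s"
        using AE_warp
      proof eventually_elim
        case (elim w)
        then have "continuous_on {a..b} (H w)" by (simp add: warp_def)
        with x show ?case unfolding continuous_on_sequentially comp_def by blast
      qed
    qed (use x in \<open>auto intro: AE_norm_H[unfolded real_norm_def]\<close>)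
  qed
  show "strict_mono_on {a..b} (mean_warp M H)"
  proof (rule strict_mono_onI)
    fix s t assume st: "s \<in> {a..b}" "t \<in> {a..b}" "s < t"
    have "AE w in M. H w s < H w t"
      using AE_warp by eventually_elim (use st in \<open>auto simp: warp_def intro: strict_mono_onD\<close>)
    then show "mean_warp M H s < mean_warp M H t"
      unfolding mean_warp_def using st
      by (intro integral_less_AE_space integrable_H) (auto simp: emeasure_space_1)
  qed
  have "AE w in M. H w a = a" "AE w in M. H w b = b"
    using AE_warp by (auto simp: warp_def)
  then have "mean_warp M H a = (\<integral>w. a \<partial>M)" "mean_warp M H b = (\<integral>w. b \<partial>M)"
    unfolding mean_warp_def using assms
    by (auto intro!: integral_cong_AE random_variable_H simp del: lebesgue_integral_const)
  then show "mean_warp M H a = a" "mean_warp M H b = b"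
    by (simp_all add: prob_space)
qed

context
  fixes h :: "nat \<Rightarrow> 'w \<Rightarrow> real \<Rightarrow> real"
  assumes ab: "a < b"
    and h_indep: "indep_vars (\<lambda>_. C_borel a b) h {1..}"
    and h_distr: "\<And>i. 1 \<le> i \<Longrightarrow> distr M (C_borel a b) (h i) = distr M (C_borel a b) H"
begin

lemma random_variable_h: "1 \<le> i \<Longrightarrow> random_variable (C_borel a b) (h i)"
  using h_indep by (auto simp: indep_vars_def)

text \<open>Being a warp is a Borel event, so its probability is determined by the law: it moves
  from \<open>H\<close> to the image measure and back to each \<open>h i\<close>. Countably many
  null sets are then united.\<close>

lemma AE_warp_sample: "AE w in M. \<forall>i\<ge>1. warp a b (h i w)"
proof -
  have pred: "{g \<in> space (C_borel a b). warp a b g} \<in> sets (C_borel a b)"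
    using measurable_warp[OF ab] by simp
  have "AE w in M. warp a b (h i w)" if "1 \<le> i" for i
  proof -
    have "AE g in distr M (C_borel a b) H. warp a b g"
      using AE_warp by (subst AE_distr_iff[OF H_random pred])
    then show ?thesis
      unfolding h_distr[OF that, symmetric]
      by (subst (asm) AE_distr_iff[OF random_variable_h[OF that] pred])
  qed
  then show ?thesis by (subst AE_all_countable) auto
qed

lemma slln_sample:
  assumes s: "s \<in> {a..b}"
  shows "AE w in M. (\<lambda>m. 1 / real m * (\<Sum>i=1..m. h i w s)) \<longlonglongrightarrow> mean_warp M H s"
  unfolding mean_warp_def
proof (rule slln_interval_bounded[OF _ _ _ AE_H_mem[OF s] ab])
  show "indep_vars (\<lambda>_. borel) (\<lambda>i w. h i w s) {1..}"
    using indep_vars_compose2[OF h_indep, of "\<lambda>_ g. g s" "\<lambda>_. borel"] measurable_eval_C_borel[OF s] by simp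
  show "distr M borel (\<lambda>w. h i w s) = distr M borel (\<lambda>w. H w s)" if "1 \<le> i" for i
  proof -
    have "distr M borel (\<lambda>w. h i w s) = distr (distr M (C_borel a b) (h i)) borel (\<lambda>g. g s)"
      using measurable_eval_C_borel[OF s] random_variable_h[OF that]
      by (simp add: distr_distr comp_def)
    also have "\<dots> = distr M borel (\<lambda>w. H w s)"
      unfolding h_distr[OF that] using measurable_eval_C_borel[OF s] H_random
      by (simp add: distr_distr comp_def)
    finally show ?thesis .
  qed
qed (use s in auto)

lemma uniform_limit_sample_mean:
  "AE w in M. uniform_limit {a..b} (\<lambda>m x. 1 / real m * (\<Sum>i=1..m. h i w x)) (mean_warp M H) sequentially"
proof -
  define s where "s = (\<lambda>N k. a + real k * (b - a) / real N)"
  have s: "s N k \<in> {a..b}" if "1 \<le> N" "k \<le> N" for N k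
    using that ab mult_left_le_one_le[of "b - a" "real k / real N"] by (auto simp: s_def)
  \<comment> \<open>The range conditions stand inside the almost sure statement, vacuous for bad
    indices, so that all grids together cost one null set.\<close>
  have "AE w in M. 1 \<le> N \<longrightarrow> k \<le> N \<longrightarrow>
      (\<lambda>m. 1 / real m * (\<Sum>i=1..m. h i w (s N k))) \<longlonglongrightarrow> mean_warp M H (s N k)" for N k
    using slln_sample[OF s[of N k]] by (cases "1 \<le> N \<and> k \<le> N") auto
  then have "AE w in M. \<forall>N k. 1 \<le> N \<longrightarrow> k \<le> N \<longrightarrow>
      (\<lambda>m. 1 / real m * (\<Sum>i=1..m. h i w (s N k))) \<longlonglongrightarrow> mean_warp M H (s N k)"
    by (simp add: AE_all_countable)
  then show ?thesis
    using AE_warp_sample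
  proof eventually_elim
    case (elim w)
    show ?case
    proof (rule uniform_limit_mono_on_grid[OF ab])
      show "mono_on {a..b} (\<lambda>x. 1 / real m * (\<Sum>i=1..m. h i w x))" for m
      proof (rule mono_onI)
        fix x y assume "x \<in> {a..b}" "y \<in> {a..b}" "x \<le> y"
        then have "h i w x \<le> h i w y" if "i \<in> {1..m}" for i
          using warp_mono[of a b "h i w" x y] elim(2) that by simp
        then show "1 / real m * (\<Sum>i=1..m. h i w x) \<le> 1 / real m * (\<Sum>i=1..m. h i w y)"
          by (intro mult_left_mono sum_mono) auto
      qed
      show "continuous_on {a..b} (mean_warp M H)"
        using warp_mean_warp[OF ab] by (simp add: warp_def)
    qed (use elim(1) in \<open>auto simp: s_def\<close>)
  qed
qed

end

end

theorem theorem2p2: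
  fixes M :: "'w measure" and a b :: real
    and H :: "'w \<Rightarrow> real \<Rightarrow> real" and h :: "nat \<Rightarrow> 'w \<Rightarrow> real \<Rightarrow> real"
    and f :: "real \<Rightarrow> real" and \<rho> :: "nat \<Rightarrow> (nat \<Rightarrow> real) \<Rightarrow> real \<Rightarrow> nat"
  assumes "a < b"
    and "warping_process M a b H"
    and "continuous_on {a..b} f" and "strict_mono_on {a..b} f"
    and "prob_space.indep_vars M (\<lambda>_. C_borel a b) h {1..}"
    and "\<And>i. i \<ge> 1 \<Longrightarrow> distr M (C_borel a b) (h i) = distr M (C_borel a b) H"
    and "nearest_rule \<rho>"
  shows "AE w in M. double_tendsto
    (\<lambda>m n. sup_norm a b (\<lambda>t. f_ES_hat \<rho> a b f (\<lambda>i. h i w) m n t - f_ES M H a b f t)) 0"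
proof -
  interpret warping_process M a b H by fact
  have "AE w in M. \<forall>i\<ge>1. warp a b (h i w)"
    by (rule AE_warp_sample[OF assms(1,5)]) (rule assms(6))
  moreover have "AE w in M. uniform_limit {a..b}
      (\<lambda>m x. 1 / real m * (\<Sum>i=1..m. h i w x)) (mean_warp M H) sequentially"
    by (rule uniform_limit_sample_mean[OF assms(1,5)]) (rule assms(6))
  ultimately show ?thesis
  proof eventually_elim
    case (elim w)
    interpret nearest_estimator a b f \<rho> "\<lambda>i. h i w"
      by unfold_locales (use assms(1,3,4,7) elim(1) in auto)
    show ?case
      unfolding f_ES_def using f_ES_hat_tendsto[OF warp_mean_warp[OF assms(1)] elim(2)] .
  qed
qed

end
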